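(* Let $d\in\mathbb{N}$, let $K=\prod_{i=1}^d[a_i,b_i]\subseteq\mathbb{R}^d$ with $a_i<b_i$ for every $i$, and let $h:K\to\mathbb{R}^d$ be bounded. Let $(\gamma_n)_{n\ge1}$ be positive real numbers with $\sum_{n=1}^\infty\gamma_n=\infty$ and $\lim_{n\to\infty}\gamma_n=0$. Let $(e_n)_{n\ge1}$ and $(r_n)_{n\ge1}$ be sequences of $\mathbb{R}^d$-valued random variables on a common probability space such that, almost surely, $\lim_{n\to\infty}|r_n|=0$ and the series $\sum_{n=1}^\infty\gamma_ne_n$ converges. Let $x_1\in K$ be arbitrary and define $$x_{n+1}=\Pi_K\big(x_n+\gamma_n(h(x_n)+e_n+r_n)\big),\qquad n\ge1.$$ Let $(X_n)_{n\ge1}$ and $(Z_n)_{n\ge1}$ be the associated sequences of shifted piecewise constant functions $[0,\infty)\to\mathbb{R}^d$ defined in the context. Then, with probability $1$, the sequences $(X_n)_n$ and $(Z_n)_n$ are equicontinuous in the extended sense. Moreover, with probability $1$, if a subsequence $(Z_{n_k})_k$ converges to a function $Z:[0,\infty)\to\mathbb{R}^d$ uniformly on $[0,T]$ for every $T>0$, then $Z$ is Lipschitz.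
   Context: $\Pi_K:\mathbb{R}^d\to K$ is the Euclidean projection onto $K$. Projection terms: $P_n=x_n+\gamma_n(e_n+r_n+h(x_n))-\Pi_K\big(x_n+\gamma_n(e_n+r_n+h(x_n))\big)$, $n\ge1$. Put $t_0=0$ and $t_n=\sum_{k=1}^n\gamma_k$. Define, for $k\ge 1$ and $t\in[t_{k-1},t_k)$, $X_1(t)=x_k$ and $Z_1(t)=\sum_{s=1}^kP_s$; and for $n\ge1$, $t\ge0$, $X_n(t)=X_1(t+t_{n-1})$ and $Z_n(t)=Z_1(t+t_{n-1})$. A sequence $(f_n)_n$ of functions $f_n:[0,\infty)\to\mathbb{R}^d$ is equicontinuous in the extended sense if for every $\varepsilon>0$ and $T>0$ there exists $\delta>0$ such that $\limsup_{n\to\infty}\ \sup\{|f_n(t)-f_n(s)|: s,t\in[0,T],\ |t-s|<\delta\}<\varepsilon$. *)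

theory Defs
  imports "HOL-Probability.Probability"
begin

text \<open>All sequences are indexed from 1 as in the source; the value at index 0 of a function
  on \<open>nat\<close> is never used.\<close>

definition step_time :: "(nat \<Rightarrow> real) \<Rightarrow> nat \<Rightarrow> real" where
  "step_time \<gamma> n = (\<Sum>k=1..n. \<gamma> k)"

text \<open>For positive step sizes with divergent sum the intervals below partition \<open>[0,\<infinity>)\<close>, so the
  description is proper for every \<open>t \<ge> 0\<close>; nothing is claimed for \<open>t < 0\<close>.\<close>

definition step_index :: "(nat \<Rightarrow> real) \<Rightarrow> real \<Rightarrow> nat" where
  "step_index \<gamma> t = (THE k. 1 \<le> k \<and> step_time \<gamma> (k - 1) \<le> t \<and> t < step_time \<gamma> k)"

definition proj_term ::
  "'a::euclidean_space set \<Rightarrow> ('a \<Rightarrow> 'a) \<Rightarrow> (nat \<Rightarrow> real) \<Rightarrow> (nat \<Rightarrow> 'a) \<Rightarrow> (nat \<Rightarrow> 'a) \<Rightarrow> (nat \<Rightarrow> 'a) \<Rightarrow> nat \<Rightarrow> 'a"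
  where
  "proj_term K h \<gamma> e r x n =
     x n + \<gamma> n *\<^sub>R (e n + r n + h (x n))
       - closest_point K (x n + \<gamma> n *\<^sub>R (e n + r n + h (x n)))"

definition interp_X :: "(nat \<Rightarrow> real) \<Rightarrow> (nat \<Rightarrow> 'a) \<Rightarrow> real \<Rightarrow> 'a" where
  "interp_X \<gamma> x t = x (step_index \<gamma> t)"

definition interp_Z :: "(nat \<Rightarrow> real) \<Rightarrow> (nat \<Rightarrow> 'a::comm_monoid_add) \<Rightarrow> real \<Rightarrow> 'a" where
  "interp_Z \<gamma> P t = (\<Sum>s=1..step_index \<gamma> t. P s)"

definition time_shift :: "(nat \<Rightarrow> real) \<Rightarrow> (real \<Rightarrow> 'a) \<Rightarrow> nat \<Rightarrow> real \<Rightarrow> 'a" where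
  "time_shift \<gamma> f n t = f (t + step_time \<gamma> (n - 1))"

text \<open>The supremum is taken in the extended reals, so that it is \<open>\<infinity>\<close> (and not an
  unspecified real number) when the oscillation is unbounded.\<close>

definition equicontinuous_ext :: "(nat \<Rightarrow> real \<Rightarrow> 'a::real_normed_vector) \<Rightarrow> bool" where
  "equicontinuous_ext f \<longleftrightarrow>
     (\<forall>\<epsilon>>0. \<forall>T>0. \<exists>\<delta>>0.
        limsup (\<lambda>n. SUP (s, t) \<in> {(s, t). s \<in> {0..T} \<and> t \<in> {0..T} \<and> \<bar>t - s\<bar> < \<delta>}.
                   ereal (norm (f n t - f n s))) < ereal \<epsilon>)"

end

theory Submission imports Defs begin

text \<open>Everything is deterministic for a fixed outcome. In each coordinate the projection is a
  two-sided Skorokhod reflection: a positive projection term can occur only on arrival at the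
  upper end of the interval, a negative one only on arrival at the lower end. Hence over any
  window the accumulated projection is dominated by the largest partial sum of the unprojected
  increments, however wide the box is. Those partial sums are at most \<open>C\<close> times the elapsed time
  plus an error vanishing at infinity, so both interpolations are Lipschitz up to a vanishing
  error, which yields equicontinuity and passes to limits of the shifts.\<close>

section \<open>Projection onto a box and reflection in a single coordinate\<close>

lemma closest_point_cbox_at_bound:
  fixes a b y :: "real ^ 'd" and i :: 'd
  assumes "\<And>i. a $ i \<le> b $ i"
  defines "q \<equiv> closest_point (cbox a b) y"
  shows "q \<in> cbox a b"
    and "(y - q) $ i > 0 \<Longrightarrow> q $ i = b $ i"
    and "(y - q) $ i < 0 \<Longrightarrow> q $ i = a $ i"
proof -
  have ne: "cbox a b \<noteq> {}"
    using assms(1) by (simp add: interval_ne_empty_cart)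
  show q: "q \<in> cbox a b"
    unfolding q_def by (rule closest_point_in_set[OF closed_cbox ne])
  \<comment> \<open>The box is a product, so replacing only coordinate \<open>i\<close> of
    \<open>q\<close> by an admissible \<open>c\<close> stays inside it; the variational inequality
    of the projection, tested there, isolates that coordinate. The choices \<open>c = b $ i\<close>
    and \<open>c = a $ i\<close> then settle the two cases.\<close>
  have le: "(y - q) $ i * (c - q $ i) \<le> 0" if c: "a $ i \<le> c" "c \<le> b $ i" for c
  proof -
    have "q + axis i (c - q $ i) \<in> cbox a b"
      using q c by (auto simp: mem_box_cart axis_def)
    then have "inner (y - q) (q + axis i (c - q $ i) - q) \<le> 0"
      unfolding q_def by (intro closest_point_dot) (auto simp: q_def)
    then show ?thesis
      by (simp add: inner_axis)
  qed
  have qi: "a $ i \<le> q $ i" "q $ i \<le> b $ i"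
    using q by (auto simp: mem_box_cart)
  show "(y - q) $ i > 0 \<Longrightarrow> q $ i = b $ i"
    using le[of "b $ i"] qi assms(1)[of i] by (auto simp: mult_le_0_iff)
  show "(y - q) $ i < 0 \<Longrightarrow> q $ i = a $ i"
    using le[of "a $ i"] qi assms(1)[of i] by (auto simp: mult_le_0_iff)
qed

text \<open>Induction on \<open>k\<close>, one inequality at a time. If the newest term is positive,
  \<open>x\<close> has just reached its maximum \<open>b\<close>, so in the telescoped identity the
  two values of \<open>x\<close> contribute at most 0 and the sum of \<open>p\<close> is at most
  that of \<open>u\<close>. Otherwise the sum has not grown and the induction hypothesis suffices.
  The lower bound is the mirror image with \<open>a\<close>. Hence \<open>b - a\<close> does not
  enter.\<close>

lemma reflection_sum_bound:
  fixes x u p :: "nat \<Rightarrow> real"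
  assumes step: "\<And>j. l < j \<Longrightarrow> x (Suc j) = x j + u j - p j"
    and range: "\<And>j. l < j \<Longrightarrow> x j \<in> {a..b}"
    and upper: "\<And>j. l < j \<Longrightarrow> p j > 0 \<Longrightarrow> x (Suc j) = b"
    and lower: "\<And>j. l < j \<Longrightarrow> p j < 0 \<Longrightarrow> x (Suc j) = a"
    and "l \<le> k"
    and bound: "\<And>j. l \<le> j \<Longrightarrow> j \<le> k \<Longrightarrow> \<bar>\<Sum>i=Suc l..j. u i\<bar> \<le> B"
  shows "\<bar>\<Sum>i=Suc l..k. p i\<bar> \<le> B"
  using \<open>l \<le> k\<close> bound
proof (induction k rule: dec_induct)
  \<comment> \<open>The sum is empty, and \<open>bound\<close> at \<open>j = l\<close> reads
    \<open>0 \<le> B\<close>.\<close>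
  case base
  then show ?case by force
next
  case (step k)
  \<comment> \<open>The first term is \<open>p (Suc l)\<close>, so the window starts at
    \<open>x (Suc l)\<close> and ends one index past the last term.\<close>
  have tele: "(\<Sum>i=Suc l..j. p i) = (\<Sum>i=Suc l..j. u i) - x (Suc j) + x (Suc l)" if "l \<le> j" for j
    using that by (induction j rule: dec_induct) (auto simp: assms(1))
  have IH: "\<bar>\<Sum>i=Suc l..k. p i\<bar> \<le> B"
    using step by auto
  have u: "\<bar>\<Sum>i=Suc l..Suc k. u i\<bar> \<le> B"
    using step.prems[of "Suc k"] step.hyps by simp
  have xl: "x (Suc l) \<in> {a..b}"
    using range by simp
  have split: "(\<Sum>i=Suc l..Suc k. p i) = (\<Sum>i=Suc l..k. p i) + p (Suc k)"
    using step.hyps by simp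
  have t: "(\<Sum>i=Suc l..Suc k. p i) = (\<Sum>i=Suc l..Suc k. u i) - x (Suc (Suc k)) + x (Suc l)"
    using tele[of "Suc k"] step.hyps by linarith
  have up: "(\<Sum>i=Suc l..Suc k. p i) \<le> B"
  proof (cases "p (Suc k) > 0")
    case True
    then have "x (Suc (Suc k)) = b"
      using upper step.hyps by simp
    then show ?thesis
      using t u xl unfolding atLeastAtMost_iff by linarith
  next
    case False
    then show ?thesis
      using IH split by linarith
  qed
  have down: "- B \<le> (\<Sum>i=Suc l..Suc k. p i)"
  proof (cases "p (Suc k) < 0")
    case True
    then have "x (Suc (Suc k)) = a"
      using lower step.hyps by simp
    then show ?thesis
      using t u xl unfolding atLeastAtMost_iff by linarith
  next
    case False
    then show ?thesis
      using IH split by linarith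
  qed
  show ?case
    using up down by linarith
qed

section \<open>Step times and the index of the interval containing a given time\<close>

lemma sum_atLeast_Suc_atMost_diff:
  fixes f :: "nat \<Rightarrow> 'a::ab_group_add"
  assumes "l \<le> k"
  shows "(\<Sum>j=Suc l..k. f j) = (\<Sum>j=1..k. f j) - (\<Sum>j=1..l. f j)"
  using assms by (induction k rule: dec_induct) auto

lemma step_time_diff:
  assumes "l \<le> k"
  shows "(\<Sum>j=Suc l..k. \<gamma> j) = step_time \<gamma> k - step_time \<gamma> l"
  unfolding step_time_def using assms by (rule sum_atLeast_Suc_atMost_diff)

lemma step_time_mono:
  assumes "\<forall>n\<ge>1. \<gamma> n > 0" "l \<le> k"
  shows "step_time \<gamma> l \<le> step_time \<gamma> k"
proof -
  have "0 \<le> (\<Sum>j=Suc l..k. \<gamma> j)"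
    using assms(1) by (intro sum_nonneg) (auto simp: less_imp_le)
  then show ?thesis using step_time_diff[OF assms(2)] by simp
qed

lemma step_time_nonneg:
  assumes "\<forall>n\<ge>1. \<gamma> n > 0"
  shows "0 \<le> step_time \<gamma> n"
  using step_time_mono[OF assms, of 0 n] by (simp add: step_time_def)

text \<open>Makes the \<open>THE\<close> in \<open>step_index\<close> usable. Divergence supplies an
  index whose step time exceeds \<open>t\<close>, and the least one qualifies; monotone step times
  keep distinct half-open intervals disjoint, which gives uniqueness.\<close>

lemma step_index:
  assumes pos: "\<forall>n\<ge>1. \<gamma> n > 0"
    and div: "filterlim (step_time \<gamma>) at_top sequentially"
    and "t \<ge> 0"
  shows "1 \<le> step_index \<gamma> t" (is ?A)
    and "step_time \<gamma> (step_index \<gamma> t - 1) \<le> t" (is ?B)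
    and "t < step_time \<gamma> (step_index \<gamma> t)" (is ?C)
proof -
  let ?P = "\<lambda>k. 1 \<le> k \<and> step_time \<gamma> (k - 1) \<le> t \<and> t < step_time \<gamma> k"
  have "\<exists>k. t < step_time \<gamma> k"
    using div unfolding filterlim_at_top_dense eventually_sequentially by blast
  define k where "k = (LEAST k. t < step_time \<gamma> k)"
  have k: "t < step_time \<gamma> k"
    unfolding k_def using \<open>\<exists>k. t < step_time \<gamma> k\<close> by (rule LeastI_ex)
  \<comment> \<open>\<open>step_time \<gamma> 0 = 0\<close> does not exceed \<open>t\<close>; so
    \<open>k - 1\<close> is a true predecessor and minimality applies to it.\<close>
  have "k \<noteq> 0"
    using k \<open>t \<ge> 0\<close> by (auto simp: step_time_def intro: gr0I)
  moreover from this have "\<not> t < step_time \<gamma> (k - 1)"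
    unfolding k_def by (intro not_less_Least) simp
  ultimately have Pk: "?P k"
    using k by simp
  have "j = k" if "?P j" for j
  proof (rule ccontr)
    assume "j \<noteq> k"
    then consider "j \<le> k - 1" | "k \<le> j - 1" by linarith
    then show False
      using step_time_mono[OF pos, of j "k - 1"] step_time_mono[OF pos, of k "j - 1"] that Pk
      by cases auto
  qed
  then have "?P (step_index \<gamma> t)"
    unfolding step_index_def using Pk by (rule theI[rotated])
  then show ?A ?B ?C by auto
qed

lemma step_index_gt:
  assumes "\<forall>n\<ge>1. \<gamma> n > 0" "filterlim (step_time \<gamma>) at_top sequentially"
    and "step_time \<gamma> l \<le> t"
  shows "l < step_index \<gamma> t"
proof (rule ccontr)
  assume "\<not> l < step_index \<gamma> t"
  then have "step_time \<gamma> (step_index \<gamma> t) \<le> step_time \<gamma> l"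
    by (intro step_time_mono assms(1)) auto
  moreover have "t \<ge> 0"
    using step_time_nonneg[OF assms(1), of l] assms(3) by linarith
  ultimately show False
    using step_index(3)[OF assms(1,2), of t] assms(3) by linarith
qed

lemma step_index_mono:
  assumes "\<forall>n\<ge>1. \<gamma> n > 0" "filterlim (step_time \<gamma>) at_top sequentially"
    and "0 \<le> s" "s \<le> t"
  shows "step_index \<gamma> s \<le> step_index \<gamma> t"
proof -
  have "step_time \<gamma> (step_index \<gamma> s - 1) \<le> t"
    using step_index(2)[OF assms(1-3)] assms(4) by linarith
  then have "step_index \<gamma> s - 1 < step_index \<gamma> t"
    by (intro step_index_gt assms(1,2))
  then show ?thesis by linarith
qed

section \<open>Functions that are Lipschitz up to a vanishing error, and their shifts\<close>

text \<open>The additive \<open>\<eta>\<close> absorbs the jumps of piecewise constant functions; it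
  may be taken arbitrarily small at the price of a later starting time.\<close>

definition asymp_lipschitz :: "real \<Rightarrow> (real \<Rightarrow> 'a::real_normed_vector) \<Rightarrow> bool" where
  "asymp_lipschitz C f \<longleftrightarrow>
     (\<forall>\<eta>>0. \<exists>\<tau>. \<forall>s t. \<tau> \<le> s \<longrightarrow> s \<le> t \<longrightarrow> norm (f t - f s) \<le> C * (t - s) + \<eta>)"

text \<open>The shift moves all of \<open>[0,\<infinity>)\<close> beyond the threshold
  \<open>\<tau>\<close>, so one \<open>N\<close> serves all \<open>s\<close> and
  \<open>t\<close>.\<close>

lemma asymp_lipschitz_time_shift:
  assumes "asymp_lipschitz C f" "filterlim (step_time \<gamma>) at_top sequentially" "\<eta> > 0"
  shows "\<exists>N. \<forall>n\<ge>N. \<forall>s\<ge>0. \<forall>t\<ge>0.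
    norm (time_shift \<gamma> f n t - time_shift \<gamma> f n s) \<le> C * \<bar>t - s\<bar> + \<eta>"
proof -
  obtain \<tau> where \<tau>: "\<And>s t. \<tau> \<le> s \<Longrightarrow> s \<le> t \<Longrightarrow> norm (f t - f s) \<le> C * (t - s) + \<eta>"
    using assms(1,3) unfolding asymp_lipschitz_def by meson
  obtain N where N: "\<And>n. n \<ge> N \<Longrightarrow> \<tau> \<le> step_time \<gamma> n"
    using assms(2) unfolding filterlim_at_top eventually_sequentially by meson
  have ord: "norm (time_shift \<gamma> f n t - time_shift \<gamma> f n s) \<le> C * \<bar>t - s\<bar> + \<eta>"
    if "Suc N \<le> n" "0 \<le> s" "s \<le> t" for n s t
  proof -
    have "N \<le> n - 1"
      using that by simp
    from N[OF this] show ?thesis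
      using \<tau>[of "s + step_time \<gamma> (n - 1)" "t + step_time \<gamma> (n - 1)"] that
      by (simp add: time_shift_def)
  qed
  have "norm (time_shift \<gamma> f n t - time_shift \<gamma> f n s) \<le> C * \<bar>t - s\<bar> + \<eta>"
    if "Suc N \<le> n" "0 \<le> s" "0 \<le> t" for n s t
    using ord[of n s t] ord[of n t s] that
    by (cases "s \<le> t") (auto simp: norm_minus_commute abs_minus_commute)
  then show ?thesis by blast
qed

lemma equicontinuous_ext_time_shift:
  assumes f: "asymp_lipschitz C f" and div: "filterlim (step_time \<gamma>) at_top sequentially"
    and "C > 0"
  shows "equicontinuous_ext (time_shift \<gamma> f)"
  unfolding equicontinuous_ext_def
proof (intro allI impI)
  fix \<epsilon> T :: real assume "\<epsilon> > 0" "T > 0"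
  \<comment> \<open>Chosen so that \<open>C * \<delta> = \<epsilon> / 4\<close>; with the error
    \<open>\<epsilon> / 4\<close> the oscillation is at most \<open>\<epsilon> / 2\<close>, which
    stays strictly below \<open>\<epsilon>\<close> after supremum and limsup.\<close>
  define \<delta> where "\<delta> = \<epsilon> / (4 * C)"
  have "\<delta> > 0"
    using \<open>\<epsilon> > 0\<close> \<open>C > 0\<close> by (simp add: \<delta>_def)
  obtain N where N: "\<And>n s t. n \<ge> N \<Longrightarrow> s \<ge> 0 \<Longrightarrow> t \<ge> 0 \<Longrightarrow>
      norm (time_shift \<gamma> f n t - time_shift \<gamma> f n s) \<le> C * \<bar>t - s\<bar> + \<epsilon> / 4"
    using asymp_lipschitz_time_shift[OF f div, of "\<epsilon> / 4"] \<open>\<epsilon> > 0\<close> by auto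
  have small: "norm (time_shift \<gamma> f n t - time_shift \<gamma> f n s) \<le> \<epsilon> / 2"
    if "n \<ge> N" "s \<ge> 0" "t \<ge> 0" "\<bar>t - s\<bar> < \<delta>" for n s t
  proof -
    have "C * \<bar>t - s\<bar> \<le> C * \<delta>"
      using that \<open>C > 0\<close> by simp
    also have "\<dots> = \<epsilon> / 4"
      using \<open>C > 0\<close> by (simp add: \<delta>_def)
    finally show ?thesis
      using N[OF that(1-3)] by linarith
  qed
  have "limsup (\<lambda>n. SUP (s, t) \<in> {(s, t). s \<in> {0..T} \<and> t \<in> {0..T} \<and> \<bar>t - s\<bar> < \<delta>}.
          ereal (norm (time_shift \<gamma> f n t - time_shift \<gamma> f n s))) \<le> ereal (\<epsilon> / 2)"
    by (intro Limsup_bounded eventually_mono[OF eventually_ge_at_top[of N]] SUP_least)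
       (use small in auto)
  also have "\<dots> < ereal \<epsilon>"
    using \<open>\<epsilon> > 0\<close> by simp
  finally show "\<exists>\<delta>>0. limsup (\<lambda>n. SUP (s, t) \<in> {(s, t). s \<in> {0..T} \<and> t \<in> {0..T} \<and> \<bar>t - s\<bar> < \<delta>}.
      ereal (norm (time_shift \<gamma> f n t - time_shift \<gamma> f n s))) < ereal \<epsilon>"
    using \<open>\<delta> > 0\<close> by blast
qed

text \<open>For fixed \<open>s\<close> and \<open>t\<close> the bound with any \<open>\<eta>\<close>
  holds eventually and survives the limit; since \<open>\<eta>\<close> is arbitrary, the limit
  carries no error term.\<close>

lemma lipschitz_on_limit_time_shift:
  assumes f: "asymp_lipschitz C f" and div: "filterlim (step_time \<gamma>) at_top sequentially"
    and "C \<ge> 0" and "strict_mono n"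
    and lim: "\<And>t. t \<ge> 0 \<Longrightarrow> (\<lambda>k. time_shift \<gamma> f (n k) t) \<longlonglongrightarrow> g t"
  shows "C-lipschitz_on {0..} g"
proof (rule lipschitz_onI)
  fix s t :: real assume st: "s \<in> {0..}" "t \<in> {0..}"
  have "norm (g s - g t) \<le> C * \<bar>s - t\<bar>"
  proof (rule field_le_epsilon)
    fix \<eta> :: real assume "\<eta> > 0"
    then obtain N where N: "\<And>m. m \<ge> N \<Longrightarrow>
        norm (time_shift \<gamma> f m s - time_shift \<gamma> f m t) \<le> C * \<bar>s - t\<bar> + \<eta>"
      using asymp_lipschitz_time_shift[OF f div] st by fastforce
    have "(\<lambda>k. norm (time_shift \<gamma> f (n k) s - time_shift \<gamma> f (n k) t)) \<longlonglongrightarrow> norm (g s - g t)"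
      using st by (intro tendsto_intros lim) auto
    moreover have "\<forall>k\<ge>N. norm (time_shift \<gamma> f (n k) s - time_shift \<gamma> f (n k) t) \<le> C * \<bar>s - t\<bar> + \<eta>"
      using N seq_suble[OF \<open>strict_mono n\<close>] le_trans by blast
    ultimately show "norm (g s - g t) \<le> C * \<bar>s - t\<bar> + \<eta>"
      by (blast intro: LIMSEQ_le_const2)
  qed
  then show "dist (g s) (g t) \<le> C * dist s t"
    by (simp add: dist_norm)
qed fact

text \<open>Passes from indices to times. The step time of the index of \<open>t\<close> exceeds
  \<open>t\<close> by at most the last step size, while that of \<open>s\<close> lies after
  \<open>s\<close>; the overshoot vanishes because \<open>\<gamma>\<close> tends to 0.\<close>

lemma asymp_lipschitz_step_index:
  fixes F :: "nat \<Rightarrow> 'a::real_normed_vector"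
  assumes pos: "\<forall>n\<ge>1. \<gamma> n > 0"
    and div: "filterlim (step_time \<gamma>) at_top sequentially"
    and "\<gamma> \<longlonglongrightarrow> 0" and "C > 0"
    and F: "\<And>\<eta>. \<eta> > 0 \<Longrightarrow> \<exists>N. \<forall>l\<ge>N. \<forall>k\<ge>l.
      norm (F k - F l) \<le> C * (step_time \<gamma> k - step_time \<gamma> l) + \<eta>"
  shows "asymp_lipschitz C (\<lambda>t. F (step_index \<gamma> t))"
  unfolding asymp_lipschitz_def
proof (intro allI impI)
  fix \<eta> :: real assume "\<eta> > 0"
  obtain N1 where N1: "\<And>l k. N1 \<le> l \<Longrightarrow> l \<le> k \<Longrightarrow>
      norm (F k - F l) \<le> C * (step_time \<gamma> k - step_time \<gamma> l) + \<eta> / 2"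
    using F[of "\<eta> / 2"] \<open>\<eta> > 0\<close> by auto
  \<comment> \<open>After multiplication by \<open>C\<close> this overshoot costs
    \<open>\<eta> / 2\<close>.\<close>
  obtain N2 where N2: "\<And>k. N2 \<le> k \<Longrightarrow> \<gamma> k < \<eta> / (2 * C)"
    using order_tendstoD(2)[OF \<open>\<gamma> \<longlonglongrightarrow> 0\<close>, of "\<eta> / (2 * C)"] \<open>\<eta> > 0\<close> \<open>C > 0\<close>
    unfolding eventually_sequentially by auto
  define \<tau> where "\<tau> = step_time \<gamma> (max N1 N2)"
  have "norm (F (step_index \<gamma> t) - F (step_index \<gamma> s)) \<le> C * (t - s) + \<eta>"
    if "\<tau> \<le> s" "s \<le> t" for s t
  proof -
    let ?l = "step_index \<gamma> s" and ?k = "step_index \<gamma> t"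
    have "s \<ge> 0"
      using that step_time_nonneg[OF pos, of "max N1 N2"] by (simp add: \<tau>_def)
    then have "t \<ge> 0" using that by simp
    have l: "max N1 N2 < ?l"
      using that by (intro step_index_gt pos div) (simp_all add: \<tau>_def)
    have lk: "?l \<le> ?k"
      by (intro step_index_mono pos div \<open>s \<ge> 0\<close> that)
    have k1: "Suc (?k - 1) = ?k"
      using l lk by simp
    have "step_time \<gamma> ?k = step_time \<gamma> (?k - 1) + \<gamma> ?k"
      using step_time_diff[of "?k - 1" ?k \<gamma>] k1 by simp
    moreover have "step_time \<gamma> (?k - 1) \<le> t" "s < step_time \<gamma> ?l"
      using step_index(2)[OF pos div \<open>t \<ge> 0\<close>] step_index(3)[OF pos div \<open>s \<ge> 0\<close>] by auto
    moreover have "\<gamma> ?k < \<eta> / (2 * C)"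
      using l lk by (intro N2) simp
    ultimately have "step_time \<gamma> ?k - step_time \<gamma> ?l \<le> t - s + \<eta> / (2 * C)"
      by linarith
    then have "C * (step_time \<gamma> ?k - step_time \<gamma> ?l) \<le> C * (t - s + \<eta> / (2 * C))"
      using \<open>C > 0\<close> by (intro mult_left_mono) auto
    also have "\<dots> = C * (t - s) + \<eta> / 2"
      using \<open>C > 0\<close> by (simp add: field_simps)
    finally show ?thesis
      using N1[of ?l ?k] l lk by linarith
  qed
  then show "\<exists>\<tau>. \<forall>s t. \<tau> \<le> s \<longrightarrow> s \<le> t \<longrightarrow>
      norm (F (step_index \<gamma> t) - F (step_index \<gamma> s)) \<le> C * (t - s) + \<eta>"
    by blast
qed

section \<open>Increments of the projected recursion\<close>

text \<open>The noise \<open>e\<close> is controlled only through its weighted sums, which are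
  Cauchy and cost \<open>\<eta>\<close>. The rest is bounded termwise: \<open>g\<close> by
  \<open>H\<close>, and \<open>r\<close> by 1 far out, whence the constant
  \<open>H + 1\<close>.\<close>

lemma perturbed_increment_bound:
  fixes g e r :: "nat \<Rightarrow> 'a::real_normed_vector"
  assumes pos: "\<forall>n\<ge>1. \<gamma> n > 0"
    and g: "\<forall>n\<ge>1. norm (g n) \<le> H"
    and r: "(\<lambda>n. norm (r n)) \<longlonglongrightarrow> 0"
    and e: "convergent (\<lambda>n. \<Sum>k=1..n. \<gamma> k *\<^sub>R e k)"
    and "\<eta> > 0"
  shows "\<exists>N. \<forall>l\<ge>N. \<forall>k\<ge>l. norm (\<Sum>j=Suc l..k. \<gamma> j *\<^sub>R (e j + r j + g j))
    \<le> (H + 1) * (step_time \<gamma> k - step_time \<gamma> l) + \<eta>"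
proof -
  obtain N1 where N1: "\<And>n. N1 \<le> n \<Longrightarrow> norm (r n) < 1"
    using order_tendstoD(2)[OF r, of 1] unfolding eventually_sequentially by auto
  obtain N2 where N2: "\<And>l k. N2 \<le> l \<Longrightarrow> N2 \<le> k \<Longrightarrow>
      norm ((\<Sum>j=1..k. \<gamma> j *\<^sub>R e j) - (\<Sum>j=1..l. \<gamma> j *\<^sub>R e j)) < \<eta>"
    using CauchyD[OF convergent_Cauchy[OF e] \<open>\<eta> > 0\<close>] by blast
  have "norm (\<Sum>j=Suc l..k. \<gamma> j *\<^sub>R (e j + r j + g j))
      \<le> (H + 1) * (step_time \<gamma> k - step_time \<gamma> l) + \<eta>"
    if "max N1 N2 \<le> l" "l \<le> k" for l k
  proof -
    have "norm (\<Sum>j=Suc l..k. \<gamma> j *\<^sub>R (r j + g j)) \<le> (\<Sum>j=Suc l..k. (H + 1) * \<gamma> j)"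
    proof (rule sum_norm_le)
      fix j assume j: "j \<in> {Suc l..k}"
      then have "norm (r j + g j) \<le> H + 1"
        using norm_triangle_ineq[of "r j" "g j"] N1[of j] g[rule_format, of j] that by auto
      then have "\<gamma> j * norm (r j + g j) \<le> \<gamma> j * (H + 1)"
        using pos[rule_format, of j] j by simp
      then show "norm (\<gamma> j *\<^sub>R (r j + g j)) \<le> (H + 1) * \<gamma> j"
        using pos[rule_format, of j] j by (simp add: mult.commute)
    qed
    also have "\<dots> = (H + 1) * (step_time \<gamma> k - step_time \<gamma> l)"
      using step_time_diff[OF that(2), of \<gamma>] by (simp flip: sum_distrib_left)
    finally have "norm (\<Sum>j=Suc l..k. \<gamma> j *\<^sub>R (r j + g j))
        \<le> (H + 1) * (step_time \<gamma> k - step_time \<gamma> l)" .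
    moreover have "norm (\<Sum>j=Suc l..k. \<gamma> j *\<^sub>R e j) < \<eta>"
      using N2[of l k] that
      by (simp add: sum_atLeast_Suc_atMost_diff[OF that(2), of "\<lambda>j. \<gamma> j *\<^sub>R e j"])
    moreover have split: "(\<Sum>j=Suc l..k. \<gamma> j *\<^sub>R (e j + r j + g j))
        = (\<Sum>j=Suc l..k. \<gamma> j *\<^sub>R e j) + (\<Sum>j=Suc l..k. \<gamma> j *\<^sub>R (r j + g j))"
      by (simp add: scaleR_add_right sum.distrib add.assoc)
    ultimately show ?thesis
      unfolding split
      using norm_triangle_ineq[of "\<Sum>j=Suc l..k. \<gamma> j *\<^sub>R e j" "\<Sum>j=Suc l..k. \<gamma> j *\<^sub>R (r j + g j)"]
      by linarith
  qed
  then show ?thesis by blast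
qed

text \<open>The reflection bound is applied in each coordinate; the dimension enters when the
  Euclidean norm is estimated by the sum of the coordinates' absolute values.\<close>

lemma projected_recursion_sum_bound:
  fixes a b :: "real ^ 'd" and x u p :: "nat \<Rightarrow> real ^ 'd"
  assumes ab: "\<And>i. a $ i \<le> b $ i"
    and x1: "x 1 \<in> cbox a b"
    and x: "\<forall>n\<ge>1. x (Suc n) = closest_point (cbox a b) (x n + u n)"
    and p: "\<forall>n\<ge>1. p n = x n + u n - closest_point (cbox a b) (x n + u n)"
    and "l \<le> k"
    and bound: "\<And>j. l \<le> j \<Longrightarrow> j \<le> k \<Longrightarrow> norm (\<Sum>i=Suc l..j. u i) \<le> B"
  shows "norm (\<Sum>i=Suc l..k. p i) \<le> real CARD('d) * B"
    and "norm (x (Suc k) - x (Suc l)) \<le> (1 + real CARD('d)) * B"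
proof -
  have step: "x (Suc n) = x n + u n - p n" if "n \<ge> 1" for n
    using x p that by simp
  have mem: "x n \<in> cbox a b" if "n \<ge> 1" for n
    using that by (induction n rule: dec_induct)
      (use x1 x closest_point_cbox_at_bound(1)[OF ab] in auto)
  have "\<bar>(\<Sum>i=Suc l..k. p i) $ c\<bar> \<le> B" for c
    unfolding sum_component
  proof (rule reflection_sum_bound[where x = "\<lambda>n. x n $ c" and u = "\<lambda>n. u n $ c"
        and a = "a $ c" and b = "b $ c"])
    fix j assume "l < j"
    then have "j \<ge> 1" by simp
    show "x (Suc j) $ c = x j $ c + u j $ c - p j $ c"
      using step[OF \<open>j \<ge> 1\<close>] by simp
    show "x j $ c \<in> {a $ c..b $ c}"
      using mem[OF \<open>j \<ge> 1\<close>] by (simp add: mem_box_cart)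
    show "p j $ c > 0 \<Longrightarrow> x (Suc j) $ c = b $ c" "p j $ c < 0 \<Longrightarrow> x (Suc j) $ c = a $ c"
      unfolding x[rule_format, OF \<open>j \<ge> 1\<close>] p[rule_format, OF \<open>j \<ge> 1\<close>]
      by (fact closest_point_cbox_at_bound(2,3)[OF ab])+
  next
    fix j assume "l \<le> j" "j \<le> k"
    then show "\<bar>\<Sum>i=Suc l..j. u i $ c\<bar> \<le> B"
      using component_le_norm_cart[of "\<Sum>i=Suc l..j. u i" c] bound[of j] by simp
  qed fact
  then have "norm (\<Sum>i=Suc l..k. p i) \<le> (\<Sum>c\<in>(UNIV::'d set). B)"
    using norm_le_l1_cart[of "\<Sum>i=Suc l..k. p i"]
    by (meson order_trans sum_mono)
  then show le: "norm (\<Sum>i=Suc l..k. p i) \<le> real CARD('d) * B"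
    by simp
  \<comment> \<open>The displacement is free motion minus projection, hence the extra 1 in the
    factor.\<close>
  have "x (Suc k) - x (Suc l) = (\<Sum>i=Suc l..k. u i) - (\<Sum>i=Suc l..k. p i)"
    using \<open>l \<le> k\<close> by (induction k rule: dec_induct) (auto simp: step algebra_simps)
  then show "norm (x (Suc k) - x (Suc l)) \<le> (1 + real CARD('d)) * B"
    using norm_triangle_ineq4[of "\<Sum>i=Suc l..k. u i" "\<Sum>i=Suc l..k. p i"] le
      bound[OF \<open>l \<le> k\<close> order_refl] by (simp add: distrib_right)
qed

lemma asymp_lipschitz_projected_recursion:
  fixes a b :: "real ^ 'd" and h :: "real ^ 'd \<Rightarrow> real ^ 'd" and e r x :: "nat \<Rightarrow> real ^ 'd"
  defines "K \<equiv> cbox a b"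
  assumes ab: "\<And>i. a $ i \<le> b $ i"
    and h: "bounded (h ` K)"
    and pos: "\<forall>n\<ge>1. \<gamma> n > 0"
    and div: "filterlim (step_time \<gamma>) at_top sequentially"
    and \<gamma>0: "\<gamma> \<longlonglongrightarrow> 0"
    and r: "(\<lambda>n. norm (r n)) \<longlonglongrightarrow> 0"
    and e: "convergent (\<lambda>n. \<Sum>k=1..n. \<gamma> k *\<^sub>R e k)"
    and x1: "x 1 \<in> K"
    and x: "\<And>n. n \<ge> 1 \<Longrightarrow> x (Suc n) = closest_point K (x n + \<gamma> n *\<^sub>R (e n + r n + h (x n)))"
  shows "\<exists>C>0. asymp_lipschitz C (interp_X \<gamma> x)
    \<and> asymp_lipschitz C (interp_Z \<gamma> (proj_term K h \<gamma> e r x))"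
proof -
  define u where "u n = \<gamma> n *\<^sub>R (e n + r n + h (x n))" for n
  define p where "p = proj_term K h \<gamma> e r x"
  have xu: "\<forall>n\<ge>1. x (Suc n) = closest_point K (x n + u n)"
    using x by (simp add: u_def)
  have pu: "\<forall>n\<ge>1. p n = x n + u n - closest_point K (x n + u n)"
    by (simp add: p_def proj_term_def u_def)
  have mem: "x n \<in> K" if "n \<ge> 1" for n
    using that by (induction n rule: dec_induct)
      (use x1 x closest_point_cbox_at_bound(1)[OF ab] in \<open>auto simp: K_def\<close>)
  obtain H where H: "H > 0" "\<And>y. y \<in> K \<Longrightarrow> norm (h y) \<le> H"
    using h unfolding bounded_pos by auto
  \<comment> \<open>\<open>D\<close> is the larger factor of the two bounds in
    \<open>projected_recursion_sum_bound\<close>. Starting from the error \<open>\<eta> / D\<close>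
    makes \<open>D * B\<close> equal to the target bound.\<close>
  define D where "D = 1 + real CARD('d)"
  define C where "C = D * (H + 1)"
  have "D > 0" "C > 0"
    using H by (auto simp: D_def C_def intro!: mult_pos_pos)
  have diff: "\<exists>N. \<forall>l\<ge>N. \<forall>k\<ge>l.
      norm (x (Suc k) - x (Suc l)) \<le> C * (step_time \<gamma> k - step_time \<gamma> l) + \<eta> \<and>
      norm (\<Sum>i=Suc l..k. p i) \<le> C * (step_time \<gamma> k - step_time \<gamma> l) + \<eta>"
    if "\<eta> > 0" for \<eta>
  proof -
    have "\<eta> / D > 0" using \<open>\<eta> > 0\<close> \<open>D > 0\<close> by simp
    then obtain N where N: "\<And>l k. N \<le> l \<Longrightarrow> l \<le> k \<Longrightarrow>
        norm (\<Sum>j=Suc l..k. u j) \<le> (H + 1) * (step_time \<gamma> k - step_time \<gamma> l) + \<eta> / D"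
      using perturbed_increment_bound[OF pos _ r e, of "\<lambda>n. h (x n)" H "\<eta> / D"] H(2) mem
      unfolding u_def by blast
    have "norm (x (Suc k) - x (Suc l)) \<le> C * (step_time \<gamma> k - step_time \<gamma> l) + \<eta> \<and>
        norm (\<Sum>i=Suc l..k. p i) \<le> C * (step_time \<gamma> k - step_time \<gamma> l) + \<eta>"
      if "N \<le> l" "l \<le> k" for l k
    proof -
      define B where "B = (H + 1) * (step_time \<gamma> k - step_time \<gamma> l) + \<eta> / D"
      \<comment> \<open>The reflection bound needs one \<open>B\<close> for every intermediate
        endpoint; step times increase, so the value at \<open>k\<close> dominates.\<close>
      have bound: "norm (\<Sum>i=Suc l..j. u i) \<le> B" if "l \<le> j" "j \<le> k" for j
      proof -
        have "(H + 1) * (step_time \<gamma> j - step_time \<gamma> l) \<le> (H + 1) * (step_time \<gamma> k - step_time \<gamma> l)"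
          using step_time_mono[OF pos \<open>j \<le> k\<close>] H by (intro mult_left_mono) auto
        then show ?thesis
          using N[OF \<open>N \<le> l\<close> \<open>l \<le> j\<close>] by (simp add: B_def)
      qed
      have "B \<ge> 0"
        using bound[of l] \<open>l \<le> k\<close> by simp
      then have "real CARD('d) * B \<le> D * B"
        by (intro mult_right_mono) (simp_all add: D_def)
      moreover have "D * B = C * (step_time \<gamma> k - step_time \<gamma> l) + \<eta>"
        using \<open>D > 0\<close> by (simp add: B_def C_def field_simps)
      ultimately show ?thesis
        using projected_recursion_sum_bound[OF ab x1[unfolded K_def] xu[unfolded K_def]
            pu[unfolded K_def] \<open>l \<le> k\<close> bound]
        by (auto simp: D_def)
    qed
    then show ?thesis by blast
  qed
  have "asymp_lipschitz C (interp_X \<gamma> x)"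
    unfolding interp_X_def[abs_def]
  proof (rule asymp_lipschitz_step_index[OF pos div \<gamma>0 \<open>C > 0\<close>])
    fix \<eta> :: real assume "\<eta> > 0"
    then obtain N1 where N1: "\<And>l k. N1 \<le> l \<Longrightarrow> l \<le> k \<Longrightarrow>
        norm (x (Suc k) - x (Suc l)) \<le> C * (step_time \<gamma> k - step_time \<gamma> l) + \<eta> / 2"
      using diff[of "\<eta> / 2"] by auto
    obtain N2 where N2: "\<And>k. N2 \<le> k \<Longrightarrow> \<gamma> k < \<eta> / (2 * C)"
      using order_tendstoD(2)[OF \<gamma>0, of "\<eta> / (2 * C)"] \<open>\<eta> > 0\<close> \<open>C > 0\<close>
      unfolding eventually_sequentially by auto
    \<comment> \<open>\<open>diff\<close> speaks about \<open>x\<close> at successors, so it is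
      applied to the predecessors of \<open>l\<close> and \<open>k\<close>. This changes the elapsed
      time by \<open>\<gamma> l - \<gamma> k\<close>, less than \<open>\<eta> / (2 * C)\<close>; the
      \<open>Suc\<close> in the threshold keeps the predecessor of \<open>l\<close> above
      \<open>N1\<close>.\<close>
    have "norm (x k - x l) \<le> C * (step_time \<gamma> k - step_time \<gamma> l) + \<eta>"
      if "Suc (max N1 N2) \<le> l" "l \<le> k" for l k
    proof -
      have lk: "0 < l" "1 \<le> k" "N1 < l" "N2 \<le> l"
        using that by auto
      then obtain l' k' where l': "l = Suc l'" "k = Suc k'"
        by (auto simp: gr0_conv_Suc Suc_le_eq)
      have "step_time \<gamma> k' - step_time \<gamma> l' = step_time \<gamma> k - step_time \<gamma> l - \<gamma> k + \<gamma> l"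
        by (simp add: l' step_time_def)
      also have "\<dots> \<le> step_time \<gamma> k - step_time \<gamma> l + \<eta> / (2 * C)"
        using N2[OF lk(4)] pos[rule_format, OF lk(2)] by simp
      finally have "C * (step_time \<gamma> k' - step_time \<gamma> l')
          \<le> C * (step_time \<gamma> k - step_time \<gamma> l + \<eta> / (2 * C))"
        using \<open>C > 0\<close> by (intro mult_left_mono) auto
      also have "\<dots> = C * (step_time \<gamma> k - step_time \<gamma> l) + \<eta> / 2"
        using \<open>C > 0\<close> by (simp add: field_simps)
      finally show ?thesis
        using N1[of l' k'] that lk by (simp add: l')
    qed
    then show "\<exists>N. \<forall>l\<ge>N. \<forall>k\<ge>l. norm (x k - x l) \<le> C * (step_time \<gamma> k - step_time \<gamma> l) + \<eta>"
      by blast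
  qed
  moreover have "asymp_lipschitz C (interp_Z \<gamma> p)"
    unfolding interp_Z_def[abs_def]
  proof (rule asymp_lipschitz_step_index[OF pos div \<gamma>0 \<open>C > 0\<close>])
    fix \<eta> :: real assume "\<eta> > 0"
    then obtain N where N: "\<And>l k. N \<le> l \<Longrightarrow> l \<le> k \<Longrightarrow>
        norm (\<Sum>i=Suc l..k. p i) \<le> C * (step_time \<gamma> k - step_time \<gamma> l) + \<eta>"
      using diff by blast
    have "norm ((\<Sum>s=1..k. p s) - (\<Sum>s=1..l. p s)) \<le> C * (step_time \<gamma> k - step_time \<gamma> l) + \<eta>"
      if "N \<le> l" "l \<le> k" for l k
      using N[OF that] unfolding sum_atLeast_Suc_atMost_diff[OF that(2)] .
    then show "\<exists>N. \<forall>l\<ge>N. \<forall>k\<ge>l. norm ((\<Sum>s=1..k. p s) - (\<Sum>s=1..l. p s))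
        \<le> C * (step_time \<gamma> k - step_time \<gamma> l) + \<eta>"
      by blast
  qed
  ultimately show ?thesis
    using \<open>C > 0\<close> by (auto simp: p_def)
qed

section \<open>Passage from single outcomes to almost sure statements\<close>

theorem theorem3p1:
  fixes M :: "'w measure"
    and a b x1 :: "real ^ 'd"
    and K :: "(real ^ 'd) set"
    and h :: "real ^ 'd \<Rightarrow> real ^ 'd"
    and \<gamma> :: "nat \<Rightarrow> real"
    and e r x :: "nat \<Rightarrow> 'w \<Rightarrow> real ^ 'd"
    and X Z :: "'w \<Rightarrow> nat \<Rightarrow> real \<Rightarrow> real ^ 'd"
  assumes "prob_space M"
    and "\<And>i. a $ i < b $ i"
    and "K = {y. \<forall>i. y $ i \<in> {a $ i..b $ i}}"
    and "bounded (h ` K)"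
    and "\<And>n. n \<ge> 1 \<Longrightarrow> \<gamma> n > 0"
    and "filterlim (\<lambda>n. \<Sum>k=1..n. \<gamma> k) at_top sequentially"
    and "\<gamma> \<longlonglongrightarrow> 0"
    and "\<And>n. n \<ge> 1 \<Longrightarrow> e n \<in> borel_measurable M"
    and "\<And>n. n \<ge> 1 \<Longrightarrow> r n \<in> borel_measurable M"
    and "AE \<omega> in M. (\<lambda>n. norm (r n \<omega>)) \<longlonglongrightarrow> 0"
    and "AE \<omega> in M. convergent (\<lambda>n. \<Sum>k=1..n. \<gamma> k *\<^sub>R e k \<omega>)"
    and "x1 \<in> K"
    and "\<And>\<omega>. \<omega> \<in> space M \<Longrightarrow> x 1 \<omega> = x1"
    and "\<And>n \<omega>. n \<ge> 1 \<Longrightarrow> \<omega> \<in> space M \<Longrightarrow>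
           x (n + 1) \<omega> = closest_point K (x n \<omega> + \<gamma> n *\<^sub>R (h (x n \<omega>) + e n \<omega> + r n \<omega>))"
    and "\<And>\<omega>. X \<omega> = time_shift \<gamma> (interp_X \<gamma> (\<lambda>n. x n \<omega>))"
    and "\<And>\<omega>. Z \<omega> = time_shift \<gamma> (interp_Z \<gamma>
           (proj_term K h \<gamma> (\<lambda>n. e n \<omega>) (\<lambda>n. r n \<omega>) (\<lambda>n. x n \<omega>)))"
  shows "(AE \<omega> in M. equicontinuous_ext (X \<omega>) \<and> equicontinuous_ext (Z \<omega>)) \<and>
    (AE \<omega> in M. \<forall>n Zlim. strict_mono n \<longrightarrow> (\<forall>k. n k \<ge> 1) \<longrightarrow>
        (\<forall>T>0. uniform_limit {0..T} (\<lambda>k. Z \<omega> (n k)) Zlim sequentially) \<longrightarrow>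
        (\<exists>L. L-lipschitz_on {0..} Zlim))"
proof -
  have K: "K = cbox a b"
    using assms(3) by (auto simp: mem_box_cart)
  have div: "filterlim (step_time \<gamma>) at_top sequentially"
    using assms(6) by (simp add: step_time_def[abs_def])
  have lip: "AE \<omega> in M. \<exists>C>0. asymp_lipschitz C (interp_X \<gamma> (\<lambda>n. x n \<omega>)) \<and>
      asymp_lipschitz C (interp_Z \<gamma> (proj_term K h \<gamma> (\<lambda>n. e n \<omega>) (\<lambda>n. r n \<omega>) (\<lambda>n. x n \<omega>)))"
    \<comment> \<open>\<open>AE_space\<close> is there because the recursion is assumed only for
      outcomes in \<open>space M\<close>.\<close>
    using assms(10,11) AE_space
  proof eventually_elim
    case (elim \<omega>)
    show ?case
      unfolding K
    proof (rule asymp_lipschitz_projected_recursion)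
      show "x (Suc n) \<omega> = closest_point (cbox a b)
          (x n \<omega> + \<gamma> n *\<^sub>R (e n \<omega> + r n \<omega> + h (x n \<omega>)))" if "n \<ge> 1" for n
        using assms(14)[OF that elim(3)] by (simp add: K algebra_simps)
    qed (use assms(2,4,5,7,12,13) elim div in \<open>auto simp: K less_imp_le\<close>)
  qed
  show ?thesis
  proof
    show "AE \<omega> in M. equicontinuous_ext (X \<omega>) \<and> equicontinuous_ext (Z \<omega>)"
      using lip unfolding assms(15,16)
      by eventually_elim (blast intro: equicontinuous_ext_time_shift div)
    show "AE \<omega> in M. \<forall>n Zlim. strict_mono n \<longrightarrow> (\<forall>k. n k \<ge> 1) \<longrightarrow>
        (\<forall>T>0. uniform_limit {0..T} (\<lambda>k. Z \<omega> (n k)) Zlim sequentially) \<longrightarrow>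
        (\<exists>L. L-lipschitz_on {0..} Zlim)"
      \<comment> \<open>The exceptional null set comes from \<open>lip\<close> and is fixed before
        the subsequence and its limit, so quantifying over uncountably many subsequences does no
        harm.\<close>
      using lip
    proof eventually_elim
      case (elim \<omega>)
      then obtain C where C: "C > 0" "asymp_lipschitz C
          (interp_Z \<gamma> (proj_term K h \<gamma> (\<lambda>n. e n \<omega>) (\<lambda>n. r n \<omega>) (\<lambda>n. x n \<omega>)))"
        by blast
      show ?case
      proof (intro allI impI)
        fix n Zlim
        assume n: "strict_mono n"
          and lim: "\<forall>T>0. uniform_limit {0..T} (\<lambda>k. Z \<omega> (n k)) Zlim sequentially"
        have "(\<lambda>k. Z \<omega> (n k) t) \<longlonglongrightarrow> Zlim t" if "t \<ge> 0" for t
          \<comment> \<open>The horizon \<open>t + 1\<close> is positive even when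
            \<open>t = 0\<close>.\<close>
          using lim[rule_format, of "t + 1"] that by (intro tendsto_uniform_limitI) auto
        then show "\<exists>L. L-lipschitz_on {0..} Zlim"
          using lipschitz_on_limit_time_shift[OF C(2) div less_imp_le[OF C(1)] n]
          unfolding assms(16) by blast
      qed
    qed
  qed
qed

end
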